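(* Let $K\ge1$ be odd, let $M_1,\dots,M_K$ be $(\epsilon,\Delta)$-differentially private mechanisms with outputs in $\{0,1\}$, let $1\le m\le K$ be a real privacy allowance, and let $\delta\ge\Delta\ge0$ with $\delta,\Delta\in[0,1)$. Consider using the algorithm DaRRM to compute an $(m\epsilon,\delta)$-differentially private majority of $M_1,\dots,M_K$, and let $f$ be the privacy cost objective (DaRRM, $f$ and the feasible regions $\mathcal F_i$ are defined in the context). Given an arbitrary noise function $\gamma:\{0,1,\dots,K\}\to[0,1]$, let the worst case probabilities be $$(p_1^*,\dots,p_K^*,p_1'^*,\dots,p_K'^* )=\operatorname*{arg\,max}_{\{(p_i,p_i')\in\mathcal F_i\}_{i=1}^K} f(p_1,\dots,p_K,p_1',\dots,p_K';\gamma).$$ Then each pair $(p_i^*,p_i'^* )$, for all $i\in\{1,\dots,K\}$, satisfies $$(p_i^*,p_i'^* )\in\Big\{(0,0),(1,1),(0,\Delta),(\Delta,0),(1-\Delta,1),(1,1-\Delta),\Big(\tfrac{e^\epsilon+\Delta}{e^\epsilon+1},\tfrac{1-\Delta}{e^\epsilon+1}\Big),\Big(\tfrac{1-\Delta}{e^\epsilon+1},\tfrac{e^\epsilon+\Delta}{e^\epsilon+1}\Big)\Big\}.$$ Furthermore, when $\delta>0$, there exists a finite vector set $\mathcal P$ of size $O(K^7)$ such that if $\beta=\max_{\{(p_i,p_i')\}_{i=1}^K\in\mathcal P} f(p_1,\dots,p_K,p_1',\dots,p_K';\gamma)$, then $$f(p_1^*,\dots,p_K^*,p_1'^*,\dots,p_K'^*;\gamma)\le\beta.$$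 When $\delta=0$, the size of $\mathcal P$ can be reduced to $O(K^3)$.
   Context: Differential privacy: a randomized mechanism $M$ is $(\epsilon,\delta)$-differentially private, $\epsilon,\delta\ge0$, if $\Pr[M(\mathcal D)\in S]\le e^\epsilon\Pr[M(\mathcal D')\in S]+\delta$ for all pairs of adjacent datasets $\mathcal D,\mathcal D'$ (differing in one entry) and all sets $S$ of outputs. DaRRM with noise function $\gamma$: draw $S_i\sim M_i(\mathcal D)$, compute $\mathcal L=\sum_{i=1}^K S_i$; with probability $\gamma(\mathcal L)$ output the majority $\mathbf 1\{\mathcal L/K\ge\frac12\}$, otherwise output a uniformly random bit. Feasible region: write $p_i=\Pr[M_i(\mathcal D)=1]$ and $p_i'=\Pr[M_i(\mathcal D')=1]$ for adjacent datasets $\mathcal D,\mathcal D'$. Since $M_i$ is $(\epsilon,\Delta)$-differentially private, $(p_i,p_i')$ lies in $\mathcal F_i$, the set of $(p,p')\in[0,1]^2$ with $p\le e^\epsilon p'+\Delta$, $p'\le e^\epsilon p+\Delta$, $1-p\le e^\epsilon(1-p')+\Delta$, $1-p'\le e^\epsilon(1-p)+\Delta$. Privacy cost objective: let $\alpha_l=\Pr[\mathcal L(\mathcal D)=l]$ and $\alpha_l'=\Pr[\mathcal L(\mathcal D')=l]$, $l\in\{0,\dots,K\}$, where $\mathcal L(\mathcal D)=\sum_i M_i(\mathcal D)$ and $\mathcal L(\mathcal D')=\sum_i M_i(\mathcal D')$ are Poisson Binomial, i.e. distributed as sums of $K$ independent Bernoulli variables with parameters $p_1,\dots,p_K$ and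 $p_1',\dots,p_K'$ respectively. Then $$f(p_1,\dots,p_K,p_1',\dots,p_K';\gamma)=\sum_{l=0}^{\frac{K-1}{2}}(e^{m\epsilon}\alpha_l'-\alpha_l)\gamma(l)+\sum_{l=\frac{K+1}{2}}^{K}(\alpha_l-e^{m\epsilon}\alpha_l')\gamma(l).$$
   Formalization: The arg max need not be unique (for γ = 0 every feasible vector maximises f, e.g. all pairs (1/2,1/2)), so the first claim is proved as: some maximiser has all its pairs in the eight-point set; the bound f(p* ) ≤ β is proved for every maximiser. *)

theory Defs
  imports "HOL-Probability.Probability" "HOL-Probability.Product_PMF"
begin

definition adjacent :: "'x list \<Rightarrow> 'x list \<Rightarrow> bool" where
  "adjacent D D' \<longleftrightarrow> length D = length D' \<and> card {j. j < length D \<and> D ! j \<noteq> D' ! j} = 1"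

definition differentially_private :: "real \<Rightarrow> real \<Rightarrow> ('x list \<Rightarrow> 'o pmf) \<Rightarrow> bool" where
  "differentially_private \<epsilon> \<delta> M \<longleftrightarrow>
     (\<forall>D D' S. adjacent D D' \<longrightarrow>
        measure_pmf.prob (M D) S \<le> exp \<epsilon> * measure_pmf.prob (M D') S + \<delta>)"

(* The outputs 1 and 0 of a mechanism are represented by True and False. *)
definition vote_count :: "nat \<Rightarrow> (nat \<Rightarrow> 'x list \<Rightarrow> bool pmf) \<Rightarrow> 'x list \<Rightarrow> nat pmf" where
  "vote_count K M D =
     map_pmf (\<lambda>S. \<Sum>i=1..K. of_bool (S i)) (Pi_pmf {1..K} False (\<lambda>i. M i D))"

definition darrm ::
  "nat \<Rightarrow> (nat \<Rightarrow> real) \<Rightarrow> (nat \<Rightarrow> 'x list \<Rightarrow> bool pmf) \<Rightarrow> 'x list \<Rightarrow> bool pmf" where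
  "darrm K \<gamma> M D =
     bind_pmf (vote_count K M D) (\<lambda>L.
     bind_pmf (bernoulli_pmf (\<gamma> L)) (\<lambda>b.
       if b then return_pmf (real L / real K \<ge> 1 / 2) else bernoulli_pmf (1 / 2)))"

definition poisson_binomial :: "nat \<Rightarrow> (nat \<Rightarrow> real) \<Rightarrow> nat pmf" where
  "poisson_binomial K p =
     map_pmf (\<lambda>S. \<Sum>i=1..K. of_bool (S i)) (Pi_pmf {1..K} False (\<lambda>i. bernoulli_pmf (p i)))"

definition noise_function :: "nat \<Rightarrow> (nat \<Rightarrow> real) \<Rightarrow> bool" where
  "noise_function K \<gamma> \<longleftrightarrow> (\<forall>l\<le>K. \<gamma> l \<in> {0..1})"

definition feasible :: "real \<Rightarrow> real \<Rightarrow> (real \<times> real) set" where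
  "feasible \<epsilon> \<Delta> = {(p, p'). p \<in> {0..1} \<and> p' \<in> {0..1} \<and>
     p \<le> exp \<epsilon> * p' + \<Delta> \<and> p' \<le> exp \<epsilon> * p + \<Delta> \<and>
     1 - p \<le> exp \<epsilon> * (1 - p') + \<Delta> \<and> 1 - p' \<le> exp \<epsilon> * (1 - p) + \<Delta>}"

(* Vectors (p_1, ..., p_K, p'_1, ..., p'_K) are functions i |-> (p_i, p'_i) on {1..K}.  They are
   taken extensional, so that distinct functions are distinct vectors and can be counted. *)
definition feasible_vectors :: "nat \<Rightarrow> real \<Rightarrow> real \<Rightarrow> (nat \<Rightarrow> real \<times> real) set" where
  "feasible_vectors K \<epsilon> \<Delta> = PiE {1..K} (\<lambda>i. feasible \<epsilon> \<Delta>)"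

definition privacy_cost ::
  "nat \<Rightarrow> real \<Rightarrow> real \<Rightarrow> (nat \<Rightarrow> real) \<Rightarrow> (nat \<Rightarrow> real \<times> real) \<Rightarrow> real" where
  "privacy_cost K m \<epsilon> \<gamma> q =
     (let \<alpha> = pmf (poisson_binomial K (\<lambda>i. fst (q i)));
          \<alpha>' = pmf (poisson_binomial K (\<lambda>i. snd (q i)))
      in (\<Sum>l=0..(K - 1) div 2. (exp (m * \<epsilon>) * \<alpha>' l - \<alpha> l) * \<gamma> l)
         + (\<Sum>l=(K + 1) div 2..K. (\<alpha> l - exp (m * \<epsilon>) * \<alpha>' l) * \<gamma> l))"

definition worst_case ::
  "nat \<Rightarrow> real \<Rightarrow> real \<Rightarrow> real \<Rightarrow> (nat \<Rightarrow> real) \<Rightarrow> (nat \<Rightarrow> real \<times> real) \<Rightarrow> bool" where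
  "worst_case K m \<epsilon> \<Delta> \<gamma> q \<longleftrightarrow>
     is_arg_max (privacy_cost K m \<epsilon> \<gamma>) (\<lambda>q. q \<in> feasible_vectors K \<epsilon> \<Delta>) q"

lemma adjacent_sym: "adjacent D D' \<Longrightarrow> adjacent D' D"
  by (auto simp: adjacent_def eq_commute)

lemma differentially_private_imp_feasible:
  assumes "differentially_private \<epsilon> \<Delta> M" "adjacent D D'"
  shows "(pmf (M D) True, pmf (M D') True) \<in> feasible \<epsilon> \<Delta>"
proof -
  have dp: "measure_pmf.prob (M A) S \<le> exp \<epsilon> * measure_pmf.prob (M B) S + \<Delta>"
    if "adjacent A B" for A B S
    using assms(1) that by (auto simp: differentially_private_def)
  note 1 = dp[OF assms(2)] and 2 = dp[OF adjacent_sym[OF assms(2)]]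
  show ?thesis
    using 1[of "{True}"] 2[of "{True}"] 1[of "{False}"] 2[of "{False}"]
    by (auto simp: feasible_def pmf_False_conv_True measure_pmf_single pmf_le_1)
qed

lemma vote_count_eq_poisson_binomial:
  "vote_count K M D = poisson_binomial K (\<lambda>i. pmf (M i D) True)"
proof -
  have "M i D = bernoulli_pmf (pmf (M i D) True)" for i
  proof (rule pmf_eqI)
    fix b show "pmf (M i D) b = pmf (bernoulli_pmf (pmf (M i D) True)) b"
      by (cases b) (auto simp: pmf_le_1 pmf_False_conv_True)
  qed
  then show ?thesis by (simp add: vote_count_def poisson_binomial_def)
qed

(* Where the objective comes from: it is the privacy constraint of DaRRM for the output 1. *)
lemma privacy_cost_darrm:
  assumes K: "odd K" and \<gamma>: "noise_function K \<gamma>"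
  shows "pmf (darrm K \<gamma> M D) True \<le> exp (m * \<epsilon>) * pmf (darrm K \<gamma> M D') True + \<delta> \<longleftrightarrow>
    privacy_cost K m \<epsilon> \<gamma> (\<lambda>i. (pmf (M i D) True, pmf (M i D') True))
      \<le> exp (m * \<epsilon>) - 1 + 2 * \<delta>"
proof -
  obtain k where k: "K = 2 * k + 1" using K by (elim oddE)
  define s where "s l = (if l \<le> k then - 1 else 1 :: real)" for l
  define A where "A D = (\<Sum>l\<le>K. pmf (vote_count K M D) l * s l * \<gamma> l)" for D
  have supp: "set_pmf (vote_count K M D) \<subseteq> {..K}" for D
  proof -
    have "(\<Sum>i=1..K. of_bool (S i)) \<le> K" for S :: "nat \<Rightarrow> bool"
      using sum_mono[of "{1..K}" "\<lambda>i. of_bool (S i)" "\<lambda>_. 1 :: nat"] by auto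
    then show ?thesis by (auto simp: vote_count_def)
  qed
  have prob: "2 * pmf (darrm K \<gamma> M D) True = 1 + A D" for D
  proof -
    have "pmf (darrm K \<gamma> M D) True = (\<Sum>l\<le>K. pmf (vote_count K M D) l *
        pmf (bind_pmf (bernoulli_pmf (\<gamma> l)) (\<lambda>b.
          if b then return_pmf (real l / real K \<ge> 1 / 2) else bernoulli_pmf (1 / 2))) True)"
      unfolding darrm_def pmf_bind[of "vote_count K M D"]
      by (subst integral_measure_pmf[of "{..K}"]) (use supp in auto)
    also have "\<dots> = (\<Sum>l\<le>K. pmf (vote_count K M D) l * (1 / 2 + s l * \<gamma> l / 2))"
    proof (intro sum.cong refl arg_cong2[where f = "(*)"])
      fix l assume "l \<in> {..K}"
      then have "\<gamma> l \<in> {0..1}" using \<gamma> by (auto simp: noise_function_def)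
      moreover have "real l / real K \<ge> 1 / 2 \<longleftrightarrow> \<not> l \<le> k"
        by (auto simp: k field_simps)
      ultimately show "pmf (bind_pmf (bernoulli_pmf (\<gamma> l)) (\<lambda>b.
          if b then return_pmf (real l / real K \<ge> 1 / 2) else bernoulli_pmf (1 / 2))) True
          = 1 / 2 + s l * \<gamma> l / 2"
        by (simp add: pmf_bind s_def field_simps)
    qed
    also have "2 * \<dots> = (\<Sum>l\<le>K. pmf (vote_count K M D) l) + A D"
      by (simp add: A_def sum_distrib_left sum.distrib[symmetric] algebra_simps)
    also have "(\<Sum>l\<le>K. pmf (vote_count K M D) l) = 1"
      using supp by (intro sum_pmf_eq_1) auto
    finally show ?thesis .
  qed
  have "{..K} = {0..k} \<union> {k + 1..K}" by (auto simp: k)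
  then have "A D - exp (m * \<epsilon>) * A D' =
      (\<Sum>l=0..k. (pmf (vote_count K M D) l - exp (m * \<epsilon>) * pmf (vote_count K M D') l) * s l * \<gamma> l)
      + (\<Sum>l=k+1..K. (pmf (vote_count K M D) l - exp (m * \<epsilon>) * pmf (vote_count K M D') l) * s l * \<gamma> l)"
    unfolding A_def sum_distrib_left sum_subtractf[symmetric]
    by (simp add: sum.union_disjoint[symmetric] algebra_simps)
  also have "\<dots> = privacy_cost K m \<epsilon> \<gamma> (\<lambda>i. (pmf (M i D) True, pmf (M i D') True))"
    unfolding privacy_cost_def Let_def vote_count_eq_poisson_binomial
    by (intro arg_cong2[where f = "(+)"] sum.cong) (auto simp: s_def k algebra_simps)
  finally have cost: "privacy_cost K m \<epsilon> \<gamma> (\<lambda>i. (pmf (M i D) True, pmf (M i D') True))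
      = A D - exp (m * \<epsilon>) * A D'" by simp
  have pq: "pmf (darrm K \<gamma> M D) True = (1 + A D) / 2" "pmf (darrm K \<gamma> M D') True = (1 + A D') / 2"
    using prob[of D] prob[of D'] by simp_all
  have "x \<le> e * y + \<delta> \<longleftrightarrow> a - e * b \<le> e - 1 + 2 * \<delta>"
    if "x = (1 + a) / 2" "y = (1 + b) / 2" for x y a b e :: real
    using that by (auto simp: algebra_simps add_divide_distrib)
  from this[OF pq] show ?thesis
    unfolding cost .
qed

end

theory Submission
  imports Defs "HOL-Computational_Algebra.Polynomial"
begin

text \<open>The generating polynomial of a Poisson binomial distribution is a product of the linear factors
  \<open>1 - p\<^sub>i + p\<^sub>i X\<close>. Hence the privacy cost is invariant under permutations of the pairs
  \<open>(p\<^sub>i, p\<^sub>i')\<close> and affine in each of them. By affinity, the pairs can be moved one at a time to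
  vertices of the polygon \<open>\<F>\<^sub>i\<close> without decreasing the cost; by invariance, only the number of
  times that each of the vertices (at most eight, and at most four if \<open>\<Delta> = 0\<close>) is used matters.\<close>

section \<open>Poisson binomial distributions\<close>

lemma pmf_map_Suc: "pmf (map_pmf Suc N) l = (case l of 0 \<Rightarrow> 0 | Suc k \<Rightarrow> pmf N k)"
  by (auto simp: pmf_map_inj' pmf_map_outside image_iff split: nat.split)

text \<open>Adding one independent Bernoulli variable mixes the distribution of the count with its
  shift by one, with weights \<open>1 - p x\<close> and \<open>p x\<close>. Multiplication by the
  linear factor does the same to the coefficients, hence the induction on \<open>A\<close>.\<close>

lemma pmf_sum_of_bool_Pi_pmf:
  fixes p :: "'i \<Rightarrow> real"
  assumes "finite A" "\<And>i. i \<in> A \<Longrightarrow> p i \<in> {0..1}"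
  shows "pmf (map_pmf (\<lambda>S. \<Sum>i\<in>A. of_bool (S i)) (Pi_pmf A False (\<lambda>i. bernoulli_pmf (p i)))) l
    = coeff (\<Prod>i\<in>A. [:1 - p i, p i:]) l"
  using assms
proof (induction A arbitrary: l rule: finite_induct)
  case empty
  then show ?case by (simp add: indicator_def)
next
  case (insert x A)
  let ?cnt = "\<lambda>S. \<Sum>i\<in>A. of_bool (S i) :: nat"
  let ?N = "map_pmf ?cnt (Pi_pmf A False (\<lambda>i. bernoulli_pmf (p i)))"
  have x: "0 \<le> p x" "p x \<le> 1" using insert.prems by auto
  have cnt: "(\<Sum>i\<in>insert x A. of_bool ((S(x := y)) i)) = (if y then Suc else id) (?cnt S)" for S y
  proof -
    have "(\<Sum>i\<in>A. of_bool ((S(x := y)) i)) = ?cnt S"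
      using insert.hyps by (intro sum.cong) auto
    then show ?thesis
      using insert.hyps by simp
  qed
  \<comment> \<open>The bit \<open>y\<close> of \<open>x\<close> is drawn first; the count over
    \<open>A\<close> is then shifted exactly when \<open>y\<close> holds.\<close>
  have "map_pmf (\<lambda>S. \<Sum>i\<in>insert x A. of_bool (S i))
      (Pi_pmf (insert x A) False (\<lambda>i. bernoulli_pmf (p i)))
    = bind_pmf (bernoulli_pmf (p x)) (\<lambda>y. map_pmf (if y then Suc else id) ?N)"
    unfolding Pi_pmf_insert'[OF insert.hyps(1,2)] map_bind_pmf map_return_pmf cnt
    by (simp add: map_pmf_def bind_assoc_pmf bind_return_pmf)
  then have "pmf (map_pmf (\<lambda>S. \<Sum>i\<in>insert x A. of_bool (S i))
      (Pi_pmf (insert x A) False (\<lambda>i. bernoulli_pmf (p i)))) l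
    = p x * pmf (map_pmf Suc ?N) l + (1 - p x) * pmf ?N l"
    using x by (simp add: pmf_bind pmf.map_id mult.commute)
  also have "\<dots> = coeff (\<Prod>i\<in>insert x A. [:1 - p i, p i:]) l"
    using insert by (simp add: pmf_map_Suc coeff_pCons split: nat.split)
  finally show ?case .
qed

text \<open>\<open>bernoulli_pmf\<close> clamps its parameter to [0,1], so the polynomial formula is
  available only for such vectors.\<close>

definition unit_vector :: "nat \<Rightarrow> (nat \<Rightarrow> real \<times> real) \<Rightarrow> bool" where
  "unit_vector K q \<longleftrightarrow> (\<forall>i\<in>{1..K}. q i \<in> {0..1} \<times> {0..1})"

text \<open>A linear functional on polynomials. For odd \<open>K\<close> and the generating
  polynomial of the vote count L, it is the expectation of \<gamma>(L), taken with sign + if the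
  majority is 1 and - if it is 0.\<close>

definition signed_sum :: "nat \<Rightarrow> (nat \<Rightarrow> real) \<Rightarrow> real poly \<Rightarrow> real" where
  "signed_sum K \<gamma> r = (\<Sum>l=(K + 1) div 2..K. coeff r l * \<gamma> l) - (\<Sum>l=0..(K - 1) div 2. coeff r l * \<gamma> l)"

lemma signed_sum_add: "signed_sum K \<gamma> (r + s) = signed_sum K \<gamma> r + signed_sum K \<gamma> s"
  by (simp add: signed_sum_def sum.distrib distrib_right)

lemma signed_sum_smult: "signed_sum K \<gamma> (smult c r) = c * signed_sum K \<gamma> r"
  by (simp add: signed_sum_def sum_distrib_left right_diff_distrib mult.assoc)

lemma privacy_cost_eq:
  assumes "unit_vector K q"
  shows "privacy_cost K m \<epsilon> \<gamma> q =
    signed_sum K \<gamma> (\<Prod>i=1..K. [:1 - fst (q i), fst (q i):])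
    - exp (m * \<epsilon>) * signed_sum K \<gamma> (\<Prod>i=1..K. [:1 - snd (q i), snd (q i):])"
proof -
  have p: "fst (q i) \<in> {0..1}" "snd (q i) \<in> {0..1}" if "i \<in> {1..K}" for i
    using assms that by (auto simp: unit_vector_def mem_Times_iff)
  have "pmf (poisson_binomial K (\<lambda>i. fst (q i))) = coeff (\<Prod>i=1..K. [:1 - fst (q i), fst (q i):])"
    "pmf (poisson_binomial K (\<lambda>i. snd (q i))) = coeff (\<Prod>i=1..K. [:1 - snd (q i), snd (q i):])"
    unfolding poisson_binomial_def using p by (intro ext pmf_sum_of_bool_Pi_pmf finite_atLeastAtMost; simp)+
  then show ?thesis
    by (simp only: privacy_cost_def signed_sum_def Let_def sum_subtractf
        left_diff_distrib right_diff_distrib sum_distrib_left mult.assoc)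
qed

text \<open>Both generating polynomials are products over the multiset of pairs, in which the order
  of the indices is lost.\<close>

lemma privacy_cost_cong_mset:
  assumes "unit_vector K q" "unit_vector K r"
    and "image_mset q (mset_set {1..K}) = image_mset r (mset_set {1..K})"
  shows "privacy_cost K m \<epsilon> \<gamma> q = privacy_cost K m \<epsilon> \<gamma> r"
proof -
  have "(\<Prod>i=1..K. g (q i)) = (\<Prod>i=1..K. g (r i))" for g :: "real \<times> real \<Rightarrow> real poly"
    using arg_cong[OF assms(3), of "\<lambda>N. prod_mset (image_mset g N)"]
    by (simp add: prod_unfold_prod_mset multiset.map_comp comp_def)
  from this[of "\<lambda>v. [:1 - fst v, fst v:]"] this[of "\<lambda>v. [:1 - snd v, snd v:]"]
  show ?thesis by (simp add: privacy_cost_eq assms(1,2))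
qed

text \<open>In each generating polynomial only the factor of index \<open>i\<close> changes, and it
  is affine in its parameter. The two polynomials enter the cost additively, so no product of the
  two components of \<open>v\<close> arises.\<close>

lemma privacy_cost_affine:
  assumes q: "unit_vector K q" and i: "i \<in> {1..K}"
  obtains a b c where "\<And>v. v \<in> {0..1} \<times> {0..1} \<Longrightarrow>
    privacy_cost K m \<epsilon> \<gamma> (q(i := v)) = a * fst v + b * snd v + c"
proof -
  define R where "R g = (\<Prod>j\<in>{1..K} - {i}. [:1 - g (q j), g (q j):])" for g :: "real \<times> real \<Rightarrow> real"
  let ?s = "signed_sum K \<gamma>"
  have prod: "(\<Prod>j=1..K. [:1 - g ((q(i := v)) j), g ((q(i := v)) j):]) = [:1 - g v, g v:] * R g" for g v
    unfolding R_def by (subst prod.remove[OF _ i]) auto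
  \<comment> \<open>The factor is 1 + x (X - 1), which separates the part of the product that is
    linear in \<open>x\<close>.\<close>
  have factor: "[:1 - x, x:] * r = r + smult x ([:- 1, 1:] * r)" for x :: real and r
  proof -
    have "[:1 - x, x:] = 1 + smult x [:- 1, 1:]" by (simp add: one_pCons)
    then show ?thesis by (simp only: distrib_right mult_smult_left mult_1)
  qed
  show ?thesis
  proof (rule that)
    fix v :: "real \<times> real" assume "v \<in> {0..1} \<times> {0..1}"
    then have "unit_vector K (q(i := v))" using q by (simp add: unit_vector_def)
    then show "privacy_cost K m \<epsilon> \<gamma> (q(i := v)) =
        ?s ([:- 1, 1:] * R fst) * fst v + (- exp (m * \<epsilon>) * ?s ([:- 1, 1:] * R snd)) * snd v
        + (?s (R fst) - exp (m * \<epsilon>) * ?s (R snd))"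
      unfolding privacy_cost_eq[OF \<open>unit_vector K (q(i := v))\<close>] prod factor signed_sum_add signed_sum_smult
      by (simp add: algebra_simps)
  qed
qed

section \<open>The feasible polygon\<close>

text \<open>The last two points lie on the line p + p' = 1, and at each of them two of the four
  privacy constraints are tight.\<close>

definition feasible_vertices :: "real \<Rightarrow> real \<Rightarrow> (real \<times> real) set" where
  "feasible_vertices \<epsilon> \<Delta> =
     {(0, 0), (1, 1), (0, \<Delta>), (\<Delta>, 0), (1 - \<Delta>, 1), (1, 1 - \<Delta>),
      ((exp \<epsilon> + \<Delta>) / (exp \<epsilon> + 1), (1 - \<Delta>) / (exp \<epsilon> + 1)),
      ((1 - \<Delta>) / (exp \<epsilon> + 1), (exp \<epsilon> + \<Delta>) / (exp \<epsilon> + 1))}"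

lemma finite_feasible_vertices: "finite (feasible_vertices \<epsilon> \<Delta>)"
  by (simp add: feasible_vertices_def)

lemma feasible_vertices_subset:
  assumes "0 \<le> \<epsilon>" "0 \<le> \<Delta>" "\<Delta> < 1"
  shows "feasible_vertices \<epsilon> \<Delta> \<subseteq> feasible \<epsilon> \<Delta>"
proof -
  define e where "e = exp \<epsilon>"
  have e: "1 \<le> e" using assms by (simp add: e_def)
  \<comment> \<open>With \<open>c\<close> the last two points become (1 - c, c) and (c, 1 - c), and
    \<open>e * c = 1 - \<Delta> - c\<close>. Once the products with \<open>e\<close> are bounded,
    every membership check is linear.\<close>
  define c where "c = (1 - \<Delta>) / (e + 1)"
  have d: "(e + \<Delta>) / (e + 1) = 1 - c" using e by (simp add: c_def field_simps)
  have c: "0 \<le> c" "e * c = 1 - \<Delta> - c" using e assms by (simp_all add: c_def field_simps)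
  have le: "\<Delta> \<le> e * \<Delta>" "c \<le> e * c"
    using mult_right_mono[OF e, of \<Delta>] mult_right_mono[OF e, of c] assms c(1) by auto
  have "w \<in> feasible \<epsilon> \<Delta>"
    if "w \<in> {(0, 0), (1, 1), (0, \<Delta>), (\<Delta>, 0), (1 - \<Delta>, 1), (1, 1 - \<Delta>), (1 - c, c), (c, 1 - c)}" for w
    using that e assms c le mult_right_mono[OF e, of "1 - \<Delta>"] mult_right_mono[OF e, of "1 - c"]
    unfolding feasible_def e_def[symmetric] right_diff_distrib by (elim insertE emptyE) (simp_all add: algebra_simps)
  then show ?thesis
    unfolding feasible_vertices_def e_def[symmetric] d c_def[symmetric] by blast
qed

text \<open>A linear functional on the quarter \<open>x \<le> y \<le> 1 - x\<close> of the polygon; the reflections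
  \<open>(x, y) \<mapsto> (y, x)\<close> and \<open>(x, y) \<mapsto> (1 - y, 1 - x)\<close> give the other quarters.\<close>

lemma linear_le_feasible_quarter:
  fixes a b B e \<Delta> x y :: real
  assumes e: "1 \<le> e" and \<Delta>: "0 \<le> \<Delta>" "\<Delta> < 1"
    and xy: "0 \<le> x" "x \<le> y" "x + y \<le> 1" "y \<le> e * x + \<Delta>"
    and B: "0 \<le> B" "b * \<Delta> \<le> B" "a + b \<le> B"
      "a * ((1 - \<Delta>) / (e + 1)) + b * ((e + \<Delta>) / (e + 1)) \<le> B"
  shows "a * x + b * y \<le> B"
proof (cases "b \<le> a")
  case True
  \<comment> \<open>For b \<le> a, moving along x + y = s to the diagonal point (s/2, s/2) does not
    decrease the functional, and the value there is at most B/2.\<close>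
  define s where "s = x + y"
  have s: "0 \<le> s" "s \<le> 1" using xy by (auto simp: s_def)
  have "(a - b) * (y - x) \<ge> 0" using True xy by simp
  then have "2 * (a * x + b * y) \<le> (a + b) * s" by (simp add: s_def algebra_simps)
  also have "\<dots> \<le> B * s" using B s by (intro mult_right_mono) auto
  also have "\<dots> \<le> B * 1" using B s by (intro mult_left_mono) auto
  finally show ?thesis using B by simp
next
  case False
  define s where "s = x + y"
  have s: "0 \<le> s" "s \<le> 1" using xy by (auto simp: s_def)
  \<comment> \<open>For b > a the functional grows along x + y = s as \<open>x\<close> shrinks. If s
    \<le> \<Delta>, the limit is x = 0, on the edge from (0, 0) to (0, \<Delta>); otherwise it is
    set by y \<le> e x + \<Delta>.\<close>
  have f: "a * x + b * y = b * s - (b - a) * x" by (simp add: s_def algebra_simps)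
  show ?thesis
  proof (cases "s \<le> \<Delta>")
    case le: True
    have "(b - a) * x \<ge> 0" using False xy by simp
    moreover have "b * s \<le> B"
    proof (cases "0 \<le> b")
      case True
      then have "b * s \<le> b * \<Delta>" using le by (intro mult_left_mono)
      then show ?thesis using B by simp
    next
      case False
      then have "b * s \<le> 0" using s by (simp add: mult_nonpos_nonneg)
      then show ?thesis using B by simp
    qed
    ultimately show ?thesis using f by simp
  next
    case gt: False
    \<comment> \<open>The extreme point is on the segment from (0, \<Delta>) to (c, 1 - c), and
      \<open>t\<close> is its position there: x + y runs from \<Delta> to 1. The bound is the
      matching convex combination of the bounds at the two ends.\<close>
    define t where "t = (s - \<Delta>) / (1 - \<Delta>)"
    define c where "c = (1 - \<Delta>) / (e + 1)"
    have t: "0 \<le> t" "t \<le> 1" "t * (1 - \<Delta>) = s - \<Delta>"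
      using gt s \<Delta> by (auto simp: t_def)
    have "(e + 1) * x \<ge> s - \<Delta>" using xy by (simp add: s_def algebra_simps)
    then have "x \<ge> t * c" using e t(3) by (simp add: c_def field_simps)
    then have "(b - a) * x \<ge> (b - a) * (t * c)" using False by (intro mult_left_mono) auto
    then have "a * x + b * y \<le> b * s - (b - a) * (t * c)" using f by simp
    also have "s = \<Delta> + t * (1 - \<Delta>)" using t by simp
    also have "b * (\<Delta> + t * (1 - \<Delta>)) - (b - a) * (t * c)
        = (1 - t) * (b * \<Delta>) + t * (a * c + b * (1 - c))"
      by (simp add: algebra_simps)
    also have "1 - c = (e + \<Delta>) / (e + 1)" using e by (simp add: c_def field_simps)
    also have "(1 - t) * (b * \<Delta>) + t * (a * c + b * ((e + \<Delta>) / (e + 1))) \<le> (1 - t) * B + t * B"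
      using B t unfolding c_def by (intro add_mono mult_left_mono) auto
    finally show ?thesis by (simp add: algebra_simps)
  qed
qed

lemma linear_le_feasible:
  assumes \<epsilon>: "0 \<le> \<epsilon>" and \<Delta>: "0 \<le> \<Delta>" "\<Delta> < 1" and v: "v \<in> feasible \<epsilon> \<Delta>"
    and B: "\<And>w. w \<in> feasible_vertices \<epsilon> \<Delta> \<Longrightarrow> a * fst w + b * snd w \<le> B"
  shows "a * fst v + b * snd v \<le> B"
proof -
  obtain x y where xy: "v = (x, y)" by fastforce
  define e where "e = exp \<epsilon>"
  define c where "c = (1 - \<Delta>) / (e + 1)"
  have e: "1 \<le> e" using \<epsilon> by (simp add: e_def)
  have d: "(e + \<Delta>) / (e + 1) = 1 - c" using e by (simp add: c_def field_simps)
  note quarter = linear_le_feasible_quarter[OF e \<Delta>, folded c_def, unfolded d]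
  have F: "0 \<le> x" "x \<le> 1" "0 \<le> y" "y \<le> 1" "x \<le> e * y + \<Delta>" "y \<le> e * x + \<Delta>"
    "1 - x \<le> e * (1 - y) + \<Delta>" "1 - y \<le> e * (1 - x) + \<Delta>"
    using v by (auto simp: feasible_def xy e_def)
  have "\<forall>w\<in>feasible_vertices \<epsilon> \<Delta>. a * fst w + b * snd w \<le> B" using B by blast
  then have V: "0 \<le> B" "a + b \<le> B" "b * \<Delta> \<le> B" "a * \<Delta> \<le> B"
    "a * (1 - \<Delta>) + b \<le> B" "a + b * (1 - \<Delta>) \<le> B"
    "a * (1 - c) + b * c \<le> B" "a * c + b * (1 - c) \<le> B"
    unfolding feasible_vertices_def e_def[symmetric] d c_def[symmetric] ball_simps fst_conv snd_conv
    by simp_all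
  consider "x \<le> y" "x + y \<le> 1" | "y \<le> x" "x + y \<le> 1"
    | "x \<le> y" "x + y \<ge> 1" | "y \<le> x" "x + y \<ge> 1" by linarith
  then have "a * x + b * y \<le> B"
  proof cases
    case 1
    show ?thesis by (rule quarter) (use F V 1 in simp_all)
  next
    case 2
    have "b * y + a * x \<le> B" by (rule quarter) (use F V 2 in \<open>simp_all add: algebra_simps\<close>)
    then show ?thesis by simp
  next
    case 3
    \<comment> \<open>Reflecting in the line x + y = 1 negates and swaps the coefficients and leaves
      the constant a + b, which is moved into the bound. The bounds at the reflected vertices are
      then the original ones.\<close>
    have "(- b) * (1 - y) + (- a) * (1 - x) \<le> B - a - b"
      by (rule quarter) (use F V 3 in \<open>simp_all add: algebra_simps\<close>)
    then show ?thesis by (simp add: algebra_simps)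
  next
    case 4
    have "(- a) * (1 - x) + (- b) * (1 - y) \<le> B - a - b"
      by (rule quarter) (use F V 4 in \<open>simp_all add: algebra_simps\<close>)
    then show ?thesis by (simp add: algebra_simps)
  qed
  then show ?thesis by (simp add: xy)
qed

text \<open>The preceding bound is applied with the largest value at the finitely many vertices,
  which some vertex attains.\<close>

lemma linear_le_feasible_vertex:
  assumes "0 \<le> \<epsilon>" "0 \<le> \<Delta>" "\<Delta> < 1" "v \<in> feasible \<epsilon> \<Delta>"
  obtains w where "w \<in> feasible_vertices \<epsilon> \<Delta>" "a * fst v + b * snd v \<le> a * fst w + b * snd w"
proof -
  let ?g = "\<lambda>w. a * fst w + b * snd w"
  let ?G = "?g ` feasible_vertices \<epsilon> \<Delta>"
  have G: "finite ?G" "?G \<noteq> {}"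
    by (simp_all add: finite_feasible_vertices) (simp add: feasible_vertices_def)
  then have "?g v \<le> Max ?G"
    by (intro linear_le_feasible[OF assms] Max_ge) auto
  moreover obtain w where "w \<in> feasible_vertices \<epsilon> \<Delta>" "Max ?G = ?g w"
    using Max_in[OF G] by auto
  ultimately show ?thesis using that by simp
qed

lemma card_feasible_vertices: "card (feasible_vertices \<epsilon> \<Delta>) \<le> 8"
proof -
  define vs where "vs = [(0, 0), (1, 1), (0, \<Delta>), (\<Delta>, 0), (1 - \<Delta>, 1), (1, 1 - \<Delta>),
      ((exp \<epsilon> + \<Delta>) / (exp \<epsilon> + 1), (1 - \<Delta>) / (exp \<epsilon> + 1)),
      ((1 - \<Delta>) / (exp \<epsilon> + 1), (exp \<epsilon> + \<Delta>) / (exp \<epsilon> + 1))]"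
  have "feasible_vertices \<epsilon> \<Delta> = set vs" "length vs = 8"
    by (simp_all only: feasible_vertices_def vs_def list.set) simp
  then show ?thesis using card_length[of vs] by simp
qed

text \<open>For \<Delta> = 0 the points (0, \<Delta>) and (\<Delta>, 0) merge with (0, 0), and (1 -
  \<Delta>, 1) and (1, 1 - \<Delta>) merge with (1, 1).\<close>

lemma card_feasible_vertices_0: "card (feasible_vertices \<epsilon> 0) \<le> 4"
proof -
  define vs where "vs = [(0, 0), (1, 1),
      (exp \<epsilon> / (exp \<epsilon> + 1), 1 / (exp \<epsilon> + 1)), (1 / (exp \<epsilon> + 1), exp \<epsilon> / (exp \<epsilon> + 1))]"
  have "feasible_vertices \<epsilon> 0 = set vs"
    unfolding feasible_vertices_def vs_def list.set add_0_right diff_zero by blast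
  moreover have "length vs = 4" by (simp add: vs_def)
  ultimately show ?thesis using card_length[of vs] by simp
qed

lemma feasible_vectors_imp_unit_vector: "q \<in> feasible_vectors K \<epsilon> \<Delta> \<Longrightarrow> unit_vector K q"
  by (force simp: feasible_vectors_def feasible_def unit_vector_def PiE_iff)

section \<open>Maximizing over the vertices\<close>

text \<open>Induction on the set \<open>J\<close> of indices already moved to vertices. The
  coefficients of the affine function are recomputed at every step, since they depend on the other
  pairs.\<close>

lemma privacy_cost_le_vertex_vector:
  assumes "0 \<le> \<epsilon>" "0 \<le> \<Delta>" "\<Delta> < 1" and q: "q \<in> feasible_vectors K \<epsilon> \<Delta>"
  obtains r where "r \<in> PiE {1..K} (\<lambda>_. feasible_vertices \<epsilon> \<Delta>)"
    "privacy_cost K m \<epsilon> \<gamma> q \<le> privacy_cost K m \<epsilon> \<gamma> r"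
proof -
  let ?f = "privacy_cost K m \<epsilon> \<gamma>"
  have "\<exists>r\<in>feasible_vectors K \<epsilon> \<Delta>. ?f q \<le> ?f r \<and> (\<forall>i\<in>J. r i \<in> feasible_vertices \<epsilon> \<Delta>)"
    if "finite J" "J \<subseteq> {1..K}" for J
    using that
  proof (induction J rule: finite_induct)
    case empty
    then show ?case using q by auto
  next
    case (insert i J)
    then obtain r where r: "r \<in> feasible_vectors K \<epsilon> \<Delta>" "?f q \<le> ?f r"
      "\<forall>i\<in>J. r i \<in> feasible_vertices \<epsilon> \<Delta>" by auto
    have i: "i \<in> {1..K}" using insert.prems by simp
    obtain a b c where affine: "\<And>v. v \<in> {0..1} \<times> {0..1} \<Longrightarrow> ?f (r(i := v)) = a * fst v + b * snd v + c"
      using privacy_cost_affine[OF feasible_vectors_imp_unit_vector[OF r(1)] i] by blast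
    have ri: "r i \<in> feasible \<epsilon> \<Delta>" using r(1) i by (auto simp: feasible_vectors_def)
    obtain w where w: "w \<in> feasible_vertices \<epsilon> \<Delta>"
      "a * fst (r i) + b * snd (r i) \<le> a * fst w + b * snd w"
      using linear_le_feasible_vertex[OF assms(1-3) ri] .
    have wf: "w \<in> feasible \<epsilon> \<Delta>" using w feasible_vertices_subset[OF assms(1-3)] by auto
    have unit: "feasible \<epsilon> \<Delta> \<subseteq> {0..1} \<times> {0..1}" by (auto simp: feasible_def)
    \<comment> \<open>\<open>r\<close> is written as an update of itself so that the affine formula
      applies to both sides.\<close>
    have "?f (r(i := r i)) \<le> ?f (r(i := w))"
      using w(2) ri wf unit by (subst (1 2) affine) auto
    then have "?f q \<le> ?f (r(i := w))" using r by simp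
    moreover have "r(i := w) \<in> feasible_vectors K \<epsilon> \<Delta>"
      using r(1) wf i by (auto simp: feasible_vectors_def PiE_iff extensional_def)
    moreover have "\<forall>j\<in>insert i J. (r(i := w)) j \<in> feasible_vertices \<epsilon> \<Delta>" using r(3) w(1) by simp
    ultimately show ?case by blast
  qed
  from this[of "{1..K}"] show ?thesis
    using that by (auto simp: feasible_vectors_def PiE_iff)
qed

text \<open>A maximum over the finitely many vertex vectors dominates every feasible vector, which
  also shows that a maximizer exists. Other maximizers need not consist of vertices: for \<gamma> =
  0 the cost vanishes identically. Hence the claim concerns a suitable maximizer.\<close>

lemma worst_case_vertex_vector:
  assumes "0 \<le> \<epsilon>" "0 \<le> \<Delta>" "\<Delta> < 1"
  obtains q where "worst_case K m \<epsilon> \<Delta> \<gamma> q" "\<forall>i\<in>{1..K}. q i \<in> feasible_vertices \<epsilon> \<Delta>"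
proof -
  let ?f = "privacy_cost K m \<epsilon> \<gamma>" and ?Q = "PiE {1..K} (\<lambda>_. feasible_vertices \<epsilon> \<Delta>)"
  have fin: "finite (?f ` ?Q)" by (simp add: finite_PiE finite_feasible_vertices)
  have "?Q \<noteq> {}" by (simp add: PiE_eq_empty_iff feasible_vertices_def)
  then have "Max (?f ` ?Q) \<in> ?f ` ?Q" by (intro Max_in fin) blast
  then obtain q where q: "q \<in> ?Q" "?f q = Max (?f ` ?Q)" by (elim imageE) simp
  have "?f r \<le> ?f q" if r: "r \<in> feasible_vectors K \<epsilon> \<Delta>" for r
  proof -
    obtain s where "s \<in> ?Q" "?f r \<le> ?f s"
      using privacy_cost_le_vertex_vector[OF assms r] .
    moreover have "?f s \<le> ?f q" unfolding q(2) using fin \<open>s \<in> ?Q\<close> by (intro Max_ge imageI)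
    ultimately show ?thesis by linarith
  qed
  moreover have "q \<in> feasible_vectors K \<epsilon> \<Delta>"
    using q(1) feasible_vertices_subset[OF assms] by (auto simp: feasible_vectors_def PiE_iff)
  ultimately have "worst_case K m \<epsilon> \<Delta> \<gamma> q"
    by (simp add: worst_case_def is_arg_max_linorder)
  then show ?thesis using that q(1) by auto
qed

section \<open>Counting vectors up to permutation\<close>

text \<open>The multiplicities of the values in \<open>V\<close> add up to \<open>card I\<close>, so
  the multiplicity of \<open>v\<close> follows from the others.\<close>

lemma image_mset_mset_set_eqI:
  assumes I: "finite I" and qr: "q ` I \<subseteq> V" "r ` I \<subseteq> V" and V: "finite V" "v \<in> V"
    and eq: "\<And>w. w \<in> V - {v} \<Longrightarrow> card {i \<in> I. q i = w} = card {i \<in> I. r i = w}"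
  shows "image_mset q (mset_set I) = image_mset r (mset_set I)"
proof (rule multiset_eqI)
  fix w
  have count: "count (image_mset f (mset_set I)) w = card {i \<in> I. f i = w}" for f :: "_ \<Rightarrow> _" and w
  proof -
    have "count (image_mset f (mset_set I)) w = (\<Sum>i | i \<in> I \<and> w = f i. 1)"
      unfolding count_image_mset' using I by (intro sum.cong) auto
    then show ?thesis by (simp add: eq_commute)
  qed
  have total: "card {i \<in> I. f i = v} + (\<Sum>w\<in>V - {v}. card {i \<in> I. f i = w}) = card I"
    if "f ` I \<subseteq> V" for f
  proof -
    have "card I = (\<Sum>w\<in>V. card {i \<in> I. f i = w})"
      using sum.group[OF I V(1) that, of "\<lambda>_. 1 :: nat"] by simp
    then show ?thesis using sum.remove[OF V, of "\<lambda>w. card {i \<in> I. f i = w}"] by simp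
  qed
  consider "w \<notin> V" | "w \<in> V - {v}" | "w = v" by auto
  then show "count (image_mset q (mset_set I)) w = count (image_mset r (mset_set I)) w"
  proof cases
    case 1
    then have "{i \<in> I. q i = w} = {i \<in> I. r i = w}" using qr by auto
    then show ?thesis by (simp add: count)
  next
    case 2
    then show ?thesis by (simp add: count eq)
  next
    case 3
    have "(\<Sum>w\<in>V - {v}. card {i \<in> I. q i = w}) = (\<Sum>w\<in>V - {v}. card {i \<in> I. r i = w})"
      using eq by (intro sum.cong) auto
    then show ?thesis using total[OF qr(1)] total[OF qr(2)] 3 by (simp add: count)
  qed
qed

text \<open>One value is left out of the exponent since the multiplicities of the others determine its own.\<close>

lemma PiE_permutation_representatives:
  fixes I :: "'a set" and V :: "'b set"
  assumes I: "finite I" and V: "finite V" "V \<noteq> {}"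
  obtains P where "P \<subseteq> PiE I (\<lambda>_. V)" "finite P" "card P \<le> (card I + 1) ^ (card V - 1)"
    "\<And>q. q \<in> PiE I (\<lambda>_. V) \<Longrightarrow>
       \<exists>r\<in>P. image_mset q (mset_set I) = image_mset r (mset_set I)"
proof -
  obtain v where v: "v \<in> V" using V by auto
  let ?Q = "PiE I (\<lambda>_. V)"
  \<comment> \<open>\<open>c q\<close> records the multiplicities of all values except
    \<open>v\<close>, and \<open>P\<close> takes one preimage of each record that occurs. Records
    are functions from \<open>V - {v}\<close> to {0, ..., card I}, which gives the bound on
    \<open>card P\<close>.\<close>
  define c where "c q = restrict (\<lambda>w. card {i \<in> I. q i = w}) (V - {v})" for q
  define P where "P = inv_into ?Q c ` c ` ?Q"
  let ?C = "PiE (V - {v}) (\<lambda>_. {..card I})"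
  have c: "c ` ?Q \<subseteq> ?C"
  proof (rule image_subsetI)
    fix q :: "'a \<Rightarrow> 'b"
    have "card {i \<in> I. q i = w} \<le> card I" for w
      using I by (intro card_mono) auto
    then show "c q \<in> ?C" by (simp add: c_def)
  qed
  have C: "finite ?C" "card ?C = (card I + 1) ^ (card V - 1)"
    using V v by (simp_all add: finite_PiE card_PiE card_Diff_singleton)
  have cQ: "finite (c ` ?Q)" using c C(1) finite_subset by blast
  show ?thesis
  proof (rule that)
    show "P \<subseteq> ?Q" unfolding P_def by (intro image_subsetI inv_into_into)
    show "finite P" using cQ by (simp add: P_def)
    show "card P \<le> (card I + 1) ^ (card V - 1)"
      using card_image_le[OF cQ, of "inv_into ?Q c"] card_mono[OF C(1) c] C(2) by (simp add: P_def)
    fix q assume q: "q \<in> ?Q"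
    define r where "r = inv_into ?Q c (c q)"
    have cq: "c q \<in> c ` ?Q" using q by (rule imageI)
    have r: "r \<in> ?Q" "c r = c q" "r \<in> P"
      unfolding r_def P_def
      by (rule inv_into_into[OF cq], rule f_inv_into_f[OF cq], rule imageI[OF cq])
    have "image_mset q (mset_set I) = image_mset r (mset_set I)"
    proof (rule image_mset_mset_set_eqI[OF I _ _ V(1) v])
      show "q ` I \<subseteq> V" "r ` I \<subseteq> V" using q r by auto
      show "card {i \<in> I. q i = w} = card {i \<in> I. r i = w}" if "w \<in> V - {v}" for w
        using fun_cong[OF r(2), of w] that by (simp add: c_def)
    qed
    then show "\<exists>r\<in>P. image_mset q (mset_set I) = image_mset r (mset_set I)" using r by auto
  qed
qed

text \<open>\<open>P\<close> represents the vertex vectors up to permutation, so it depends only on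
  the vertices and \<open>K\<close> and serves every \<gamma> at once. Its vectors are feasible, so
  the maximum over \<open>P\<close> does not exceed the worst case either.\<close>

lemma dominating_vectors:
  assumes "0 \<le> \<epsilon>" "0 \<le> \<Delta>" "\<Delta> < 1" and K: "1 \<le> K" and d: "card (feasible_vertices \<epsilon> \<Delta>) \<le> d + 1"
  shows "\<exists>P. finite P \<and> P \<noteq> {} \<and> P \<subseteq> feasible_vectors K \<epsilon> \<Delta> \<and> real (card P) \<le> 2 ^ d * real K ^ d \<and>
    (\<forall>\<gamma> q. noise_function K \<gamma> \<and> worst_case K m \<epsilon> \<Delta> \<gamma> q \<longrightarrow>
      privacy_cost K m \<epsilon> \<gamma> q \<le> Max (privacy_cost K m \<epsilon> \<gamma> ` P))"
proof -
  let ?V = "feasible_vertices \<epsilon> \<Delta>" and ?f = "privacy_cost K m \<epsilon>"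
  let ?Q = "PiE {1..K} (\<lambda>_. ?V)"
  have V0: "?V \<noteq> {}" by (simp add: feasible_vertices_def)
  obtain P where P: "P \<subseteq> ?Q" "finite P" "card P \<le> (card {1..K} + 1) ^ (card ?V - 1)"
    "\<And>q. q \<in> ?Q \<Longrightarrow> \<exists>r\<in>P. image_mset q (mset_set {1..K}) = image_mset r (mset_set {1..K})"
    using PiE_permutation_representatives[OF finite_atLeastAtMost finite_feasible_vertices V0] by blast
  have Q: "?Q \<subseteq> feasible_vectors K \<epsilon> \<Delta>"
    unfolding feasible_vectors_def using feasible_vertices_subset[OF assms(1-3)] by (intro PiE_mono) auto
  have "?Q \<noteq> {}" using V0 by (simp add: PiE_eq_empty_iff)
  then have "P \<noteq> {}" using P(4) by blast
  moreover have "?f \<gamma> q \<le> Max (?f \<gamma> ` P)" if q: "q \<in> feasible_vectors K \<epsilon> \<Delta>" for \<gamma> q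
  proof -
    obtain s where s: "s \<in> ?Q" "?f \<gamma> q \<le> ?f \<gamma> s"
      using privacy_cost_le_vertex_vector[OF assms(1-3) q] .
    obtain r where r: "r \<in> P" "image_mset s (mset_set {1..K}) = image_mset r (mset_set {1..K})"
      using P(4)[OF s(1)] by auto
    have "?f \<gamma> s = ?f \<gamma> r"
      using r s(1) P(1) Q by (intro privacy_cost_cong_mset feasible_vectors_imp_unit_vector) auto
    also have "\<dots> \<le> Max (?f \<gamma> ` P)" using P(2) r(1) by (intro Max_ge) auto
    finally show ?thesis using s(2) by simp
  qed
  moreover have "real (card P) \<le> 2 ^ d * real K ^ d"
  proof -
    \<comment> \<open>The factor \<open>2 ^ d\<close> comes from K + 1 \<le> 2 K.\<close>
    have "card P \<le> (K + 1) ^ d"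
      by (rule order_trans[OF P(3)]) (use d in \<open>auto intro!: power_increasing\<close>)
    also have "\<dots> \<le> (2 * K) ^ d" using K by (intro power_mono) auto
    finally have "real (card P) \<le> real ((2 * K) ^ d)" by (rule of_nat_mono)
    then show ?thesis by (simp add: power_mult_distrib)
  qed
  ultimately show ?thesis
    using P(1,2) Q by (intro exI[of _ P]) (auto simp: worst_case_def is_arg_max_def)
qed

theorem lemma5p1:
  shows "\<exists>C\<^sub>7 C\<^sub>3 :: real.
    \<forall>(K :: nat) (\<epsilon> :: real) (\<Delta> :: real) (\<delta> :: real) (m :: real)
      (M :: nat \<Rightarrow> 'x list \<Rightarrow> bool pmf).
      1 \<le> K \<and> odd K \<and> 0 \<le> \<epsilon> \<and> 0 \<le> \<Delta> \<and> \<Delta> \<le> \<delta> \<and> \<Delta> < 1 \<and> \<delta> < 1 \<and> 1 \<le> m \<and> m \<le> real K \<and>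
      (\<forall>i\<in>{1..K}. differentially_private \<epsilon> \<Delta> (M i)) \<longrightarrow>
      (\<forall>\<gamma>. noise_function K \<gamma> \<longrightarrow>
         (\<exists>q. worst_case K m \<epsilon> \<Delta> \<gamma> q \<and>
            (\<forall>i\<in>{1..K}. q i \<in>
               {(0, 0), (1, 1), (0, \<Delta>), (\<Delta>, 0), (1 - \<Delta>, 1), (1, 1 - \<Delta>),
                ((exp \<epsilon> + \<Delta>) / (exp \<epsilon> + 1), (1 - \<Delta>) / (exp \<epsilon> + 1)),
                ((1 - \<Delta>) / (exp \<epsilon> + 1), (exp \<epsilon> + \<Delta>) / (exp \<epsilon> + 1))}))) \<and>
      (\<delta> > 0 \<longrightarrow>
         (\<exists>P. finite P \<and> P \<noteq> {} \<and> P \<subseteq> feasible_vectors K \<epsilon> \<Delta> \<and>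
            real (card P) \<le> C\<^sub>7 * real K ^ 7 \<and>
            (\<forall>\<gamma> q. noise_function K \<gamma> \<and> worst_case K m \<epsilon> \<Delta> \<gamma> q \<longrightarrow>
               privacy_cost K m \<epsilon> \<gamma> q \<le> Max (privacy_cost K m \<epsilon> \<gamma> ` P)))) \<and>
      (\<delta> = 0 \<longrightarrow>
         (\<exists>P. finite P \<and> P \<noteq> {} \<and> P \<subseteq> feasible_vectors K \<epsilon> \<Delta> \<and>
            real (card P) \<le> C\<^sub>3 * real K ^ 3 \<and>
            (\<forall>\<gamma> q. noise_function K \<gamma> \<and> worst_case K m \<epsilon> \<Delta> \<gamma> q \<longrightarrow>
               privacy_cost K m \<epsilon> \<gamma> q \<le> Max (privacy_cost K m \<epsilon> \<gamma> ` P))))"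
\<comment> \<open>Both constants are instances of \<open>2 ^ d\<close>: eight vertices give d = 7,
  and four give d = 3.\<close>
proof (rule exI[of _ "2 ^ 7"], rule exI[of _ "2 ^ 3"], intro allI impI conjI)
  fix K :: nat and \<epsilon> \<Delta> \<delta> m :: real and M :: "nat \<Rightarrow> 'x list \<Rightarrow> bool pmf"
  assume "1 \<le> K \<and> odd K \<and> 0 \<le> \<epsilon> \<and> 0 \<le> \<Delta> \<and> \<Delta> \<le> \<delta> \<and> \<Delta> < 1 \<and> \<delta> < 1 \<and> 1 \<le> m \<and> m \<le> real K \<and>
      (\<forall>i\<in>{1..K}. differentially_private \<epsilon> \<Delta> (M i))"
  then have \<epsilon>\<Delta>: "0 \<le> \<epsilon>" "0 \<le> \<Delta>" "\<Delta> < 1" and K: "1 \<le> K" and \<delta>: "\<Delta> \<le> \<delta>" by auto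
  {
    fix \<gamma>
    show "\<exists>q. worst_case K m \<epsilon> \<Delta> \<gamma> q \<and> (\<forall>i\<in>{1..K}. q i \<in>
               {(0, 0), (1, 1), (0, \<Delta>), (\<Delta>, 0), (1 - \<Delta>, 1), (1, 1 - \<Delta>),
                ((exp \<epsilon> + \<Delta>) / (exp \<epsilon> + 1), (1 - \<Delta>) / (exp \<epsilon> + 1)),
                ((1 - \<Delta>) / (exp \<epsilon> + 1), (exp \<epsilon> + \<Delta>) / (exp \<epsilon> + 1))})"
      using worst_case_vertex_vector[OF \<epsilon>\<Delta>, of K m \<gamma>] unfolding feasible_vertices_def by blast
  }
  show "\<exists>P. finite P \<and> P \<noteq> {} \<and> P \<subseteq> feasible_vectors K \<epsilon> \<Delta> \<and> real (card P) \<le> 2 ^ 7 * real K ^ 7 \<and>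
      (\<forall>\<gamma> q. noise_function K \<gamma> \<and> worst_case K m \<epsilon> \<Delta> \<gamma> q \<longrightarrow>
         privacy_cost K m \<epsilon> \<gamma> q \<le> Max (privacy_cost K m \<epsilon> \<gamma> ` P))"
    using card_feasible_vertices by (intro dominating_vectors \<epsilon>\<Delta> K) auto
  \<comment> \<open>Here 0 \<le> \<Delta> \<le> \<delta> forces \<Delta> = 0, and at most four
    distinct vertices remain.\<close>
  assume "\<delta> = 0"
  then have "\<Delta> = 0" using \<epsilon>\<Delta> \<delta> by simp
  then show "\<exists>P. finite P \<and> P \<noteq> {} \<and> P \<subseteq> feasible_vectors K \<epsilon> \<Delta> \<and> real (card P) \<le> 2 ^ 3 * real K ^ 3 \<and>
      (\<forall>\<gamma> q. noise_function K \<gamma> \<and> worst_case K m \<epsilon> \<Delta> \<gamma> q \<longrightarrow>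
         privacy_cost K m \<epsilon> \<gamma> q \<le> Max (privacy_cost K m \<epsilon> \<gamma> ` P))"
    using card_feasible_vertices_0 by (intro dominating_vectors \<epsilon>\<Delta> K) auto
qed

end
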